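(* Let $\mathbb{K}$, $\mathcal{A}$, $\mathcal{A}_\varepsilon$ and the notion of a system in C-form be as in the context. Consider two systems in C-form for the same algebra $\mathcal{A}$ and of the same dimension $N$, $$\mathrm{d} \boldsymbol{G}_i(\boldsymbol{x},\varepsilon) = \varepsilon\,\boldsymbol{A}^{(i)}(\boldsymbol{x})\,\boldsymbol{G}_i(\boldsymbol{x},\varepsilon),\qquad i=1,2.$$ Assume that there are matrices of full rank $$\boldsymbol{\Delta}(\boldsymbol{x},\varepsilon)\in \mathrm{GL}(N,\mathcal{A}_\varepsilon)\quad\text{and}\quad \boldsymbol{H}(\varepsilon)\in\mathrm{GL}(N,\mathbb{C}(\varepsilon))$$ such that $$\boldsymbol{G}_1(\boldsymbol{x},\varepsilon)\,\big(\boldsymbol{H}(\varepsilon)^{-1}\big)^T\,\boldsymbol{G}_2(\boldsymbol{x},\varepsilon)^T=\boldsymbol{\Delta}(\boldsymbol{x},\varepsilon).$$ Then $\mathrm{d}\boldsymbol{\Delta}(\boldsymbol{x},\varepsilon)=0$.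
   Context: $\mathbb{K}$ is an algebraic number field (a field obtained by adjoining to $\mathbb{Q}$ finitely many algebraic numbers). $\boldsymbol{x}=(x_1,\dots,x_r)$ are local coordinates and $\mathrm{d}=\sum_{k=1}^r \mathrm{d}x_k\,\partial_{x_k}$ is the total differential with respect to $\boldsymbol{x}$ only ($\varepsilon$ is a parameter). $\mathcal{A}$ is a $\mathbb{K}$-algebra of functions of $\boldsymbol{x}$ that is differentially closed ($f\in\mathcal{A}$ implies $\partial_{x_k}f\in\mathcal{A}$ for all $k$) and whose constants are exactly $\mathbb{K}$, i.e. $\{f\in\mathcal{A}:\partial_{x_k}f=0\text{ for all }k\}=\mathbb{K}$. $\Omega^1(\mathcal{A})$ is the $\mathbb{K}$-vector space of one-forms $\sum_k \mathrm{d}x_k\, f_k$ with $f_k\in\mathcal{A}$, and $Z^1(\mathcal{A})=\{\omega\in\Omega^1(\mathcal{A}):\mathrm{d}\omega=0\}$. Furthermore $\mathcal{A}_\varepsilon=\mathcal{A}\otimes_{\mathbb{K}}\mathbb{K}(\varepsilon)$, and $\mathcal{F}_{\mathbb{C}}=\mathrm{Frac}(\mathbb{C}\otimes_{\mathbb{K}}\mathcal{A})$ is the field of fractions, with $\mathrm{d}\mathcal{F}_{\mathbb{C}}=\{\mathrm{d}f:f\in\mathcal{F}_{\mathbb{C}}\}$. For a ring $R$, $\mathrm{GL}(N,R)$ denotes the $N\times N$ matrices over $R$ of full rank (invertible). An $\varepsilon$-factorised system of dimension $N$ (for the algebra $\mathcal{A}$) is a differential equation $\mathrm{d}\boldsymbol{G}(\boldsymbol{x},\varepsilon)=\varepsilon\boldsymbol{A}(\boldsymbol{x})\boldsymbol{G}(\boldsymbol{x},\varepsilon)$,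 where $\boldsymbol{G}$ is an $N\times N$ matrix and $\boldsymbol{A}(\boldsymbol{x})$ is an $N\times N$ matrix of one-forms in $\Omega^1(\mathcal{A})$ satisfying the flatness condition $\mathrm{d}\boldsymbol{A}=\boldsymbol{A}\wedge\boldsymbol{A}=0$. The entries of $\boldsymbol{A}$ generate a finite-dimensional $\mathbb{K}$-subspace $\mathbb{A}\subseteq Z^1(\mathcal{A})$, and the system is said to be in C-form if $\mathbb{A}\cap\mathrm{d}\mathcal{F}_{\mathbb{C}}=\{0\}$.
   Formalization: Added assumption: the K-span of the entries of A^(1) and A^(2) together meets dF_C only in 0. Separate C-form is not enough: for A=Q[x,1/x], A^(1)_12=dx/x, A^(2)_21=dx-dx/x, H=1, one gets the non-constant Delta=[[1,εx],[0,1]]. *)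

theory Defs
  imports "HOL-Analysis.Analysis" "HOL-Computational_Algebra.Computational_Algebra"
begin

text \<open>
  Functions of \<open>x\<close> and \<open>\<epsilon>\<close> are elements of an arbitrary commutative ring \<open>'g\<close> with commuting
  derivations \<open>D k\<close>, one for each coordinate \<open>x\<^sub>k\<close>, \<open>k :: 'r\<close>. A ring homomorphism
  \<open>\<kappa> :: complex poly fract \<Rightarrow> 'g\<close> embeds the rational functions \<open>\<complex>(\<epsilon>)\<close>.
\<close>

subsection \<open>Number fields and rational functions in \<open>\<epsilon>\<close>\<close>

definition is_subfield :: "complex set \<Rightarrow> bool" where
  "is_subfield F \<longleftrightarrow> 1 \<in> F \<and>
     (\<forall>a\<in>F. \<forall>b\<in>F. a - b \<in> F \<and> a * b \<in> F \<and> inverse a \<in> F)"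

definition number_field :: "complex set \<Rightarrow> bool" where
  "number_field K \<longleftrightarrow>
     (\<exists>S. finite S \<and> (\<forall>a\<in>S. algebraic a) \<and> K = \<Inter>{F. is_subfield F \<and> S \<subseteq> F})"

definition const_rat :: "complex \<Rightarrow> complex poly fract" where
  "const_rat c = Fraction_Field.Fract [:c:] 1"

definition eps_rat :: "complex poly fract" where
  "eps_rat = Fraction_Field.Fract [:0, 1:] 1"

definition rat_functions :: "complex set \<Rightarrow> complex poly fract set" where
  "rat_functions K = {Fraction_Field.Fract p q | p q.
     (\<forall>i. coeff p i \<in> K) \<and> (\<forall>i. coeff q i \<in> K) \<and> q \<noteq> 0}"


subsection \<open>Differential rings and one-forms\<close>

definition hom_on :: "'a::comm_ring_1 set \<Rightarrow> ('a \<Rightarrow> 'b::comm_ring_1) \<Rightarrow> bool" where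
  "hom_on S h \<longleftrightarrow> h 1 = 1 \<and>
     (\<forall>a\<in>S. \<forall>b\<in>S. h (a + b) = h a + h b \<and> h (a * b) = h a * h b)"

definition partial_derivations :: "('r \<Rightarrow> 'a::comm_ring_1 \<Rightarrow> 'a) \<Rightarrow> bool" where
  "partial_derivations D \<longleftrightarrow>
     (\<forall>k f g. D k (f + g) = D k f + D k g \<and> D k (f * g) = D k f * g + f * D k g) \<and>
     (\<forall>k l f. D k (D l f) = D l (D k f))"

text \<open>The one-form \<open>\<Sum>\<^sub>k dx\<^sub>k f\<^sub>k\<close> is the vector of its coefficients \<open>f\<^sub>k\<close>; a two-form
  \<open>\<Sum>\<^sub>p\<^sub><\<^sub>q dx\<^sub>p \<and> dx\<^sub>q g\<^sub>p\<^sub>q\<close> is the antisymmetric array of its coefficients.\<close>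

type_synonym ('a, 'r) form1 = "'a ^ 'r"
type_synonym ('a, 'r) form2 = "'a ^ 'r ^ 'r"

definition diff0 :: "('r::finite \<Rightarrow> 'a \<Rightarrow> 'a) \<Rightarrow> 'a::comm_ring_1 \<Rightarrow> ('a, 'r) form1" where
  "diff0 D f = (\<chi> k. D k f)"

definition diff1 :: "('r::finite \<Rightarrow> 'a \<Rightarrow> 'a) \<Rightarrow> ('a::comm_ring_1, 'r) form1 \<Rightarrow> ('a, 'r) form2" where
  "diff1 D \<omega> = (\<chi> p q. D p (\<omega> $ q) - D q (\<omega> $ p))"

definition wedge :: "('a::comm_ring_1, 'r::finite) form1 \<Rightarrow> ('a, 'r) form1 \<Rightarrow> ('a, 'r) form2" where
  "wedge \<omega> \<eta> = (\<chi> p q. \<omega> $ p * \<eta> $ q - \<omega> $ q * \<eta> $ p)"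

definition map_form :: "('a \<Rightarrow> 'b) \<Rightarrow> ('a, 'r::finite) form1 \<Rightarrow> ('b, 'r) form1" where
  "map_form h \<omega> = (\<chi> k. h (\<omega> $ k))"

definition wedge_matrix ::
  "('a::comm_ring_1, 'r::finite) form1 ^ 'n ^ 'n \<Rightarrow> ('a, 'r) form1 ^ 'n ^ 'n
     \<Rightarrow> ('a, 'r) form2 ^ 'n ^ 'n::finite" where
  "wedge_matrix A B = (\<chi> i j. \<Sum>l\<in>UNIV. wedge (A $ i $ l) (B $ l $ j))"

definition form_matrix_mult ::
  "('a::comm_ring_1, 'r::finite) form1 ^ 'n ^ 'n \<Rightarrow> 'a ^ 'n ^ 'n
     \<Rightarrow> ('a, 'r) form1 ^ 'n ^ 'n::finite" where
  "form_matrix_mult A G = (\<chi> i j. \<Sum>l\<in>UNIV. (G $ l $ j) *s (A $ i $ l))"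

definition entries :: "'a ^ 'n ^ 'm \<Rightarrow> 'a set" where
  "entries M = {M $ i $ j | i j. True}"

definition GL :: "'a::comm_ring_1 set \<Rightarrow> ('a ^ 'n ^ 'n::finite) set" where
  "GL S = {M. entries M \<subseteq> S \<and>
     (\<exists>M'. entries M' \<subseteq> S \<and> M ** M' = mat 1 \<and> M' ** M = mat 1)}"


subsection \<open>Tensor products over \<open>K\<close> realised inside a ring\<close>

text \<open>
  For \<open>K\<close>-linear maps \<open>\<phi>\<close> on \<open>X\<close> and \<open>\<psi>\<close> on \<open>Y\<close>, \<open>tensor_image\<close> is the image of
  \<open>X \<otimes>\<^sub>K Y\<close> under \<open>a \<otimes> y \<mapsto> \<phi> a * \<psi> y\<close>, and \<open>tensor_embeds\<close> says that this map is injective;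
  \<open>s\<close> is the embedding of \<open>K\<close> into the ring containing \<open>Y\<close>.
\<close>

definition tensor_image ::
  "'x set \<Rightarrow> ('x \<Rightarrow> 'a::comm_ring_1) \<Rightarrow> 'y set \<Rightarrow> ('y \<Rightarrow> 'a) \<Rightarrow> 'a set" where
  "tensor_image X \<phi> Y \<psi> = {\<Sum>i<n. \<phi> (a i) * \<psi> (y i) | (n::nat) a y.
     (\<forall>i<n. a i \<in> X) \<and> (\<forall>i<n. y i \<in> Y)}"

definition K_independent ::
  "complex set \<Rightarrow> (complex \<Rightarrow> 'y::comm_ring_1) \<Rightarrow> nat \<Rightarrow> (nat \<Rightarrow> 'y) \<Rightarrow> bool" where
  "K_independent K s n y \<longleftrightarrow>
     (\<forall>c. (\<forall>i<n. c i \<in> K) \<longrightarrow> (\<Sum>i<n. s (c i) * y i) = 0 \<longrightarrow> (\<forall>i<n. c i = 0))"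

definition tensor_embeds ::
  "complex set \<Rightarrow> (complex \<Rightarrow> 'y::comm_ring_1) \<Rightarrow> 'x::zero set \<Rightarrow> ('x \<Rightarrow> 'a::comm_ring_1)
     \<Rightarrow> 'y set \<Rightarrow> ('y \<Rightarrow> 'a) \<Rightarrow> bool" where
  "tensor_embeds K s X \<phi> Y \<psi> \<longleftrightarrow>
     (\<forall>n a y. (\<forall>i<n. a i \<in> X) \<longrightarrow> (\<forall>i<n. y i \<in> Y) \<longrightarrow> K_independent K s n y \<longrightarrow>
        (\<Sum>i<n. \<phi> (a i) * \<psi> (y i)) = 0 \<longrightarrow> (\<forall>i<n. a i = 0))"


subsection \<open>The differential algebra, its extension by \<open>\<epsilon>\<close>, and the field of fractions\<close>

definition const_fun :: "(complex poly fract \<Rightarrow> 'g) \<Rightarrow> complex \<Rightarrow> 'g" where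
  "const_fun \<kappa> c = \<kappa> (const_rat c)"

text \<open>The last condition holds because elements of \<open>\<A>\<close> do not depend on \<open>\<epsilon>\<close>; it identifies
  \<open>\<A> \<otimes>\<^sub>K K(\<epsilon>)\<close> with the subring \<open>A_eps\<close> below.\<close>

locale function_algebra =
  fixes K :: "complex set"
    and \<kappa> :: "complex poly fract \<Rightarrow> 'g::comm_ring_1"
    and D :: "'r::finite \<Rightarrow> 'g \<Rightarrow> 'g"
    and \<A> :: "'g set"
  assumes number_field: "number_field K"
    and derivations: "partial_derivations D"
    and hom_eps: "hom_on UNIV \<kappa>"
    and eps_const: "\<And>k q. D k (\<kappa> q) = 0"
    and alg_const: "\<And>c. c \<in> K \<Longrightarrow> const_fun \<kappa> c \<in> \<A>"
    and alg_diff: "\<And>f g. f \<in> \<A> \<Longrightarrow> g \<in> \<A> \<Longrightarrow> f - g \<in> \<A>"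
    and alg_mult: "\<And>f g. f \<in> \<A> \<Longrightarrow> g \<in> \<A> \<Longrightarrow> f * g \<in> \<A>"
    and alg_closed: "\<And>k f. f \<in> \<A> \<Longrightarrow> D k f \<in> \<A>"
    and constants: "{f \<in> \<A>. \<forall>k. D k f = 0} = const_fun \<kappa> ` K"
    and eps_free: "tensor_embeds K const_rat \<A> id (rat_functions K) \<kappa>"

definition A_eps :: "complex set \<Rightarrow> (complex poly fract \<Rightarrow> 'g::comm_ring_1) \<Rightarrow> 'g set \<Rightarrow> 'g set" where
  "A_eps K \<kappa> \<A> = tensor_image \<A> id (rat_functions K) \<kappa>"

text \<open>
  The field \<open>'f\<close> is \<open>Frac(\<complex> \<otimes>\<^sub>K \<A>)\<close>, with \<open>j\<close> and \<open>\<gamma>\<close> the canonical maps from \<open>\<A>\<close> and \<open>\<complex>\<close>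
  and \<open>\<delta>\<close> the \<open>\<complex>\<close>-linear extension of the derivations.
\<close>

locale fraction_field = function_algebra K \<kappa> D \<A>
  for K :: "complex set"
    and \<kappa> :: "complex poly fract \<Rightarrow> 'g::comm_ring_1"
    and D :: "'r::finite \<Rightarrow> 'g \<Rightarrow> 'g"
    and \<A> :: "'g set" +
  fixes j :: "'g \<Rightarrow> 'f::field"
    and \<gamma> :: "complex \<Rightarrow> 'f"
    and \<delta> :: "'r \<Rightarrow> 'f \<Rightarrow> 'f"
  assumes hom_alg: "hom_on \<A> j"
    and hom_complex: "hom_on UNIV \<gamma>"
    and maps_agree: "\<And>c. c \<in> K \<Longrightarrow> j (const_fun \<kappa> c) = \<gamma> c"
    and embeds: "tensor_embeds K id \<A> j UNIV \<gamma>"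
    and fractions: "\<And>f. \<exists>p \<in> tensor_image \<A> j UNIV \<gamma>.
                          \<exists>q \<in> tensor_image \<A> j UNIV \<gamma>. q \<noteq> 0 \<and> f = p / q"
    and derivations_frac: "partial_derivations \<delta>"
    and complex_const: "\<And>k c. \<delta> k (\<gamma> c) = 0"
    and derivations_extend: "\<And>k f. f \<in> \<A> \<Longrightarrow> \<delta> k (j f) = j (D k f)"


subsection \<open>Systems in C-form\<close>

definition forms1 :: "'g set \<Rightarrow> ('g, 'r::finite) form1 set" where
  "forms1 \<A> = {\<omega>. \<forall>k. \<omega> $ k \<in> \<A>}"

definition flat_connection ::
  "('r::finite \<Rightarrow> 'g \<Rightarrow> 'g) \<Rightarrow> 'g::comm_ring_1 set \<Rightarrow> ('g, 'r) form1 ^ 'n ^ 'n::finite \<Rightarrow> bool" where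
  "flat_connection D \<A> A \<longleftrightarrow>
     entries A \<subseteq> forms1 \<A> \<and> map_matrix (diff1 D) A = 0 \<and> wedge_matrix A A = 0"

definition eps_solution ::
  "(complex poly fract \<Rightarrow> 'g) \<Rightarrow> ('r::finite \<Rightarrow> 'g \<Rightarrow> 'g) \<Rightarrow> ('g, 'r) form1 ^ 'n ^ 'n
     \<Rightarrow> 'g::comm_ring_1 ^ 'n ^ 'n::finite \<Rightarrow> bool" where
  "eps_solution \<kappa> D A G \<longleftrightarrow>
     map_matrix (diff0 D) G = map_matrix (\<lambda>\<omega>. \<kappa> eps_rat *s \<omega>) (form_matrix_mult A G)"

definition K_span ::
  "complex set \<Rightarrow> (complex poly fract \<Rightarrow> 'g::comm_ring_1) \<Rightarrow> ('g, 'r::finite) form1 set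
     \<Rightarrow> ('g, 'r) form1 set" where
  "K_span K \<kappa> S = {\<Sum>\<omega>\<in>T. const_fun \<kappa> (c \<omega>) *s \<omega> | T c.
     finite T \<and> T \<subseteq> S \<and> (\<forall>\<omega>\<in>T. c \<omega> \<in> K)}"

definition meets_exact_trivially ::
  "('g \<Rightarrow> 'f) \<Rightarrow> ('r::finite \<Rightarrow> 'f::field \<Rightarrow> 'f) \<Rightarrow> ('g, 'r) form1 set \<Rightarrow> bool" where
  "meets_exact_trivially j \<delta> V \<longleftrightarrow> map_form j ` V \<inter> range (diff0 \<delta>) = {0}"

definition C_form ::
  "complex set \<Rightarrow> (complex poly fract \<Rightarrow> 'g) \<Rightarrow> ('r::finite \<Rightarrow> 'g \<Rightarrow> 'g) \<Rightarrow> 'g set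
     \<Rightarrow> ('g \<Rightarrow> 'f) \<Rightarrow> ('r \<Rightarrow> 'f::field \<Rightarrow> 'f) \<Rightarrow> ('g::comm_ring_1, 'r) form1 ^ 'n ^ 'n::finite
     \<Rightarrow> bool" where
  "C_form K \<kappa> D \<A> j \<delta> A \<longleftrightarrow>
     flat_connection D \<A> A \<and> meets_exact_trivially j \<delta> (K_span K \<kappa> (entries A))"

text \<open>
  For two systems, the C-form of each does not exclude exact forms in the space generated by the
  entries of both: take \<open>K = \<rat>\<close>, \<open>\<A> = \<rat>[x, 1/x]\<close>, \<open>L = log x\<close>, and let \<open>A1\<close>, \<open>A2\<close> be zero
  except for \<open>A1\<^sub>1\<^sub>2 = dx/x\<close> and \<open>A2\<^sub>2\<^sub>1 = dx - dx/x\<close>. The unipotent solutions \<open>G1\<close>, \<open>G2\<close> have entries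
  \<open>(G1)\<^sub>1\<^sub>2 = \<epsilon> L\<close> and \<open>(G2)\<^sub>2\<^sub>1 = \<epsilon> (x - L)\<close>, and \<open>G1 ** transpose G2\<close> is the unipotent matrix over
  \<open>\<A>[\<epsilon>]\<close> with upper right entry \<open>\<epsilon> x\<close>, which is not constant. So a pair of systems is said
  to be in C-form for the same algebra only if, in addition to the C-form of each,
  \<open>meets_exact_trivially\<close> holds for the span of \<open>entries A1 \<union> entries A2\<close>; this is automatic
  when \<open>A1\<close> and \<open>A2\<close> generate the same space.
\<close>

end

theory Submission
  imports Defs
begin

text \<open>
  The relation gives \<open>d\<Delta> = \<epsilon> (A1 \<Delta> + \<Delta> A2\<^sup>T)\<close>, in which \<open>G1\<close>, \<open>G2\<close>, \<open>H\<close> no longer occur. Multiply by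
  a common denominator \<open>q \<in> K[\<epsilon>]\<close>, so that \<open>q \<Delta> = \<Sum>\<^sub>m X\<^sub>m \<epsilon>\<^sup>m\<close> with matrices \<open>X\<^sub>m\<close> over \<open>\<A>\<close>. Since powers
  of \<open>\<epsilon>\<close> are independent over \<open>\<A>\<close>, \<open>dX\<^sub>0 = 0\<close> and \<open>dX\<^sub>m\<^sub>+\<^sub>1 = A1 X\<^sub>m + X\<^sub>m A2\<^sup>T\<close>. If \<open>X\<^sub>m\<close> has entries in \<open>K\<close>,
  the right-hand side is an exact matrix with entries in the \<open>K\<close>-span of the entries of \<open>A1\<close> and
  \<open>A2\<close>, hence it vanishes and \<open>X\<^sub>m\<^sub>+\<^sub>1\<close> has entries in \<open>K\<close> as well.
\<close>

no_notation fps_nth (infixl "$" 75)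

section \<open>Subfields, derivations and powers of \<epsilon>\<close>

lemma is_subfield_number_field:
  assumes "number_field K"
  shows "is_subfield K"
proof -
  obtain S where "K = \<Inter>{F. is_subfield F \<and> S \<subseteq> F}"
    using assms unfolding number_field_def by blast
  then show ?thesis
    by (auto simp: is_subfield_def)
qed

lemma partial_derivations_0: "partial_derivations D \<Longrightarrow> D k 0 = 0"
  unfolding partial_derivations_def by (metis add_cancel_right_right)

lemma partial_derivations_sum:
  assumes "partial_derivations D"
  shows "D k (\<Sum>i\<in>I. f i) = (\<Sum>i\<in>I. D k (f i))"
proof (cases "finite I")
  case True
  then show ?thesis
    by (induction I rule: finite_induct)
      (use assms in \<open>auto simp: partial_derivations_0 partial_derivations_def\<close>)
qed (simp add: partial_derivations_0[OF assms])

lemma map_matrix_derivation_mult: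
  assumes "partial_derivations D"
  shows "map_matrix (D k) (X ** Y) = map_matrix (D k) X ** Y + X ** map_matrix (D k) Y"
proof -
  have "D k (f * g) = D k f * g + f * D k g" for f g
    using assms by (simp add: partial_derivations_def)
  then show ?thesis
    by (simp add: vec_eq_iff matrix_matrix_mult_def partial_derivations_sum[OF assms] sum.distrib)
qed

lemma const_rat_to_fract: "const_rat c = to_fract [:c:]"
  by (simp add: const_rat_def to_fract_def)

lemma eps_rat_to_fract: "eps_rat = to_fract [:0, 1:]"
  by (simp add: eps_rat_def to_fract_def)

lemma eps_rat_power: "eps_rat ^ i = to_fract (monom 1 i)"
  by (induction i) (simp_all add: eps_rat_to_fract monom_Suc flip: to_fract_mult)

lemma tensor_embedsD:
  assumes "tensor_embeds K s X \<phi> Y \<psi>" "\<And>i. i < n \<Longrightarrow> a i \<in> X" "\<And>i. i < n \<Longrightarrow> y i \<in> Y"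
    and "K_independent K s n y" "(\<Sum>i<n. \<phi> (a i) * \<psi> (y i)) = 0" "i < n"
  shows "a i = 0"
  by (rule assms(1)[unfolded tensor_embeds_def, rule_format, of n a y i]) (use assms in auto)

section \<open>Closure properties of \<open>K\<close> and \<A>\<close>

context function_algebra
begin

lemma subfield: "is_subfield K"
  by (rule is_subfield_number_field[OF number_field])

lemma K_1: "1 \<in> K" and K_diff: "a \<in> K \<Longrightarrow> b \<in> K \<Longrightarrow> a - b \<in> K"
  and K_mult: "a \<in> K \<Longrightarrow> b \<in> K \<Longrightarrow> a * b \<in> K"
  using subfield by (auto simp: is_subfield_def)

lemma K_0: "0 \<in> K"
  using K_diff[OF K_1 K_1] by simp

lemma K_add: "a \<in> K \<Longrightarrow> b \<in> K \<Longrightarrow> a + b \<in> K"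
  using K_diff[of a "0 - b"] K_diff[OF K_0] by simp

lemma K_sum: "(\<And>i. i \<in> I \<Longrightarrow> f i \<in> K) \<Longrightarrow> sum f I \<in> K"
  by (induction I rule: infinite_finite_induct) (auto simp: K_0 K_add)

lemma kappa_1: "\<kappa> 1 = 1" and kappa_add: "\<kappa> (u + v) = \<kappa> u + \<kappa> v"
  and kappa_mult: "\<kappa> (u * v) = \<kappa> u * \<kappa> v"
  using hom_eps by (auto simp: hom_on_def)

lemma kappa_0: "\<kappa> 0 = 0"
  using kappa_add[of 0 0] by simp

lemma kappa_power: "\<kappa> (u ^ n) = \<kappa> u ^ n"
  by (induction n) (simp_all add: kappa_1 kappa_mult)

lemma const_fun_0: "const_fun \<kappa> 0 = 0"
  and const_fun_add: "const_fun \<kappa> (a + b) = const_fun \<kappa> a + const_fun \<kappa> b"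
  by (simp_all add: const_fun_def const_rat_to_fract kappa_0
      flip: kappa_add to_fract_add)

lemma alg_0: "0 \<in> \<A>"
  using alg_const[OF K_0] by (simp add: const_fun_0)

lemma alg_add: "f \<in> \<A> \<Longrightarrow> g \<in> \<A> \<Longrightarrow> f + g \<in> \<A>"
  using alg_diff[of f "0 - g"] alg_diff[OF alg_0] by simp

lemma alg_sum: "(\<And>i. i \<in> I \<Longrightarrow> f i \<in> \<A>) \<Longrightarrow> sum f I \<in> \<A>"
  by (induction I rule: infinite_finite_induct) (auto simp: alg_0 alg_add)

section \<open>Polynomials in \<epsilon> over \<A> and common denominators\<close>

lemma kappa_to_fract: "\<kappa> (to_fract p) = poly (map_poly (const_fun \<kappa>) p) (\<kappa> eps_rat)"
proof (induction p)
  case (pCons a p)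
  have "to_fract (pCons a p) = const_rat a + eps_rat * to_fract p"
    by (simp add: const_rat_to_fract eps_rat_to_fract flip: to_fract_add to_fract_mult)
  then show ?case
    using pCons by (simp add: kappa_add kappa_mult map_poly_pCons const_fun_0 flip: const_fun_def[of \<kappa>])
qed (simp add: kappa_0)

text \<open>Distinct powers of \<epsilon> are linearly independent over \<open>K\<close>, and
  \<open>eps_free\<close> carries this over to independence over \<A>. This makes it possible to
  compare coefficients of powers of \<epsilon>.\<close>

lemma poly_eps_rat_eq_0:
  assumes p: "\<And>i. coeff p i \<in> \<A>" and "poly p (\<kappa> eps_rat) = 0"
  shows "p = 0"
proof -
  \<comment> \<open>The successor puts the leading coefficient among the indices
    \<open>i < n\<close>.\<close>
  define n where "n = Suc (degree p)"
  have indep: "K_independent K const_rat n (\<lambda>i. eps_rat ^ i)"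
    unfolding K_independent_def
  proof (intro allI impI)
    fix c :: "nat \<Rightarrow> complex" and i
    assume "(\<Sum>i<n. const_rat (c i) * eps_rat ^ i) = 0" "i < n"
    moreover have "(\<Sum>i<n. const_rat (c i) * eps_rat ^ i) = to_fract (\<Sum>i<n. monom (c i) i)"
      by (induction n)
        (simp_all add: const_rat_to_fract eps_rat_power smult_monom flip: to_fract_mult)
    ultimately have "coeff (\<Sum>i<n. monom (c i) i) i = 0"
      by (metis to_fract_eq_0_iff coeff_0)
    with \<open>i < n\<close> show "c i = 0"
      by (simp add: coeff_sum)
  qed
  have "eps_rat ^ i \<in> rat_functions K" for i
    unfolding rat_functions_def eps_rat_power to_fract_def using K_0 K_1
    by (intro CollectI exI[of _ "monom 1 i"] exI[of _ 1]) (auto simp: coeff_1)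
  moreover have "(\<Sum>i<n. id (coeff p i) * \<kappa> (eps_rat ^ i)) = 0"
    using assms(2) by (simp add: poly_altdef n_def kappa_power lessThan_Suc_atMost)
  ultimately have "coeff p i = 0" if "i < n" for i
    by (rule tensor_embedsD[OF eps_free p _ indep _ that])
  then have "lead_coeff p = 0"
    by (simp add: n_def)
  then show ?thesis
    by simp
qed

lemma poly_eps_rat_inject:
  assumes "\<And>i. coeff p i \<in> \<A>" "\<And>i. coeff q i \<in> \<A>"
    and "poly p (\<kappa> eps_rat) = poly q (\<kappa> eps_rat)"
  shows "p = q"
  using poly_eps_rat_eq_0[of "p - q"] assms by (simp add: alg_diff)

text \<open>Since \<epsilon> is a constant of every derivation, only the coefficients are
  differentiated.\<close>

lemma derivation_poly_eps_rat:
  "D k (poly p (\<kappa> eps_rat)) = poly (map_poly (D k) p) (\<kappa> eps_rat)"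
proof (induction p)
  case (pCons a p)
  then show ?case
    using derivations eps_const[of k eps_rat]
    by (simp add: map_poly_pCons partial_derivations_0[OF derivations] partial_derivations_def)
qed (simp add: partial_derivations_0[OF derivations])

text \<open>Denominators are expressed by multiplication because \<open>'g\<close> is only a ring:
  \<open>q\<close> is a denominator of \<open>f\<close> if their product lies in
  \<A>[\<epsilon>].\<close>

definition clears :: "complex poly \<Rightarrow> 'g \<Rightarrow> bool" where
  "clears q f \<longleftrightarrow> (\<exists>p. (\<forall>i. coeff p i \<in> \<A>) \<and> \<kappa> (to_fract q) * f = poly p (\<kappa> eps_rat))"

text \<open>The constants from \<open>K\<close> belong to \<A>, so a factor from K[\<epsilon>] keeps
  the numerator in \<A>[\<epsilon>]. Hence finitely many denominators can be multiplied
  together.\<close>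

lemma clears_mult:
  assumes r: "\<And>i. coeff r i \<in> K" and "clears q f"
  shows "clears (r * q) f"
proof -
  obtain p where p: "\<And>i. coeff p i \<in> \<A>" "\<kappa> (to_fract q) * f = poly p (\<kappa> eps_rat)"
    using assms by (auto simp: clears_def)
  have "coeff (map_poly (const_fun \<kappa>) r * p) i \<in> \<A>" for i
    using r p by (auto simp: coeff_mult coeff_map_poly const_fun_0 intro!: alg_sum alg_mult alg_const)
  moreover have "\<kappa> (to_fract (r * q)) * f = poly (map_poly (const_fun \<kappa>) r * p) (\<kappa> eps_rat)"
    by (simp add: kappa_mult mult.assoc p kappa_to_fract[of r])
  ultimately show ?thesis
    unfolding clears_def by blast
qed

lemma clears_sum:
  assumes "\<And>i. i \<in> I \<Longrightarrow> clears q (f i)"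
  shows "clears q (\<Sum>i\<in>I. f i)"
proof -
  obtain p where p: "\<And>i m. i \<in> I \<Longrightarrow> coeff (p i) m \<in> \<A>"
    "\<And>i. i \<in> I \<Longrightarrow> \<kappa> (to_fract q) * f i = poly (p i) (\<kappa> eps_rat)"
    using assms unfolding clears_def by metis
  then show ?thesis
    unfolding clears_def
    by (intro exI[of _ "\<Sum>i\<in>I. p i"])
      (auto simp: coeff_sum poly_sum sum_distrib_left intro!: alg_sum)
qed

lemma common_denominator:
  assumes "finite S" "\<And>f. f \<in> S \<Longrightarrow> \<exists>q. (\<forall>i. coeff q i \<in> K) \<and> q \<noteq> 0 \<and> clears q f"
  shows "\<exists>q. (\<forall>i. coeff q i \<in> K) \<and> q \<noteq> 0 \<and> (\<forall>f\<in>S. clears q f)"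
  using assms
proof (induction S rule: finite_induct)
  case empty
  then show ?case
    using K_0 K_1 by (intro exI[of _ 1]) (auto simp: coeff_1)
next
  case (insert f S)
  then obtain q r where q: "\<And>i. coeff q i \<in> K" "q \<noteq> 0" "\<And>g. g \<in> S \<Longrightarrow> clears q g"
    and r: "\<And>i. coeff r i \<in> K" "r \<noteq> 0" "clears r f"
    by (metis insertCI)
  have "clears (q * r) g" if "g \<in> insert f S" for g
    using that clears_mult[OF q(1) r(3)] clears_mult[OF r(1) q(3)]
    by (auto simp: mult.commute[of q])
  moreover have "coeff (q * r) i \<in> K" for i
    using q r by (auto simp: coeff_mult intro!: K_sum K_mult)
  ultimately show ?case
    using q r by (intro exI[of _ "q * r"]) auto
qed

text \<open>In each summand of the tensor, the denominator of the rational factor already suffices;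
  a common denominator of the summands then serves for the sum.\<close>

lemma A_eps_denominator:
  assumes "f \<in> A_eps K \<kappa> \<A>"
  shows "\<exists>q. (\<forall>i. coeff q i \<in> K) \<and> q \<noteq> 0 \<and> clears q f"
proof -
  obtain n :: nat and a y where f: "f = (\<Sum>i<n. a i * \<kappa> (y i))"
    and a: "\<And>i. i < n \<Longrightarrow> a i \<in> \<A>" and y: "\<And>i. i < n \<Longrightarrow> y i \<in> rat_functions K"
    using assms by (auto simp: A_eps_def tensor_image_def)
  have "\<exists>q. (\<forall>m. coeff q m \<in> K) \<and> q \<noteq> 0 \<and> clears q (a i * \<kappa> (y i))" if i: "i < n" for i
  proof -
    obtain p q where pq: "y i = Fraction_Field.Fract p q" "\<And>m. coeff p m \<in> K"
      "\<And>m. coeff q m \<in> K" "q \<noteq> 0"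
      using y[OF i] unfolding rat_functions_def by blast
    then have "to_fract q * y i = to_fract p"
      by (simp add: Fract_conv_to_fract)
    then have "\<kappa> (to_fract q) * (a i * \<kappa> (y i)) = a i * \<kappa> (to_fract p)"
      by (metis kappa_mult mult.left_commute)
    moreover have "coeff (smult (a i) (map_poly (const_fun \<kappa>) p)) m \<in> \<A>" for m
      using a[OF i] pq by (simp add: coeff_map_poly const_fun_0 alg_mult alg_const)
    ultimately have "clears q (a i * \<kappa> (y i))"
      unfolding clears_def
      by (intro exI[of _ "smult (a i) (map_poly (const_fun \<kappa>) p)"]) (auto simp: kappa_to_fract)
    with pq show ?thesis
      by blast
  qed
  then have "\<exists>q. (\<forall>m. coeff q m \<in> K) \<and> q \<noteq> 0 \<and> (\<forall>f\<in>(\<lambda>i. a i * \<kappa> (y i)) ` {..<n}. clears q f)"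
    by (intro common_denominator) auto
  then obtain q where "\<And>m. coeff q m \<in> K" "q \<noteq> 0" "\<And>i. i < n \<Longrightarrow> clears q (a i * \<kappa> (y i))"
    by auto
  then show ?thesis
    unfolding f using clears_sum[of "{..<n}" q "\<lambda>i. a i * \<kappa> (y i)"] by auto
qed

section \<open>The \<open>K\<close>-span of a set of one-forms\<close>

lemma K_span_0: "0 \<in> K_span K \<kappa> S"
  unfolding K_span_def by (intro CollectI exI[of _ "{}"]) auto

lemma K_span_scale:
  assumes "c \<in> K" "\<omega> \<in> S"
  shows "const_fun \<kappa> c *s \<omega> \<in> K_span K \<kappa> S"
  unfolding K_span_def using assms by (intro CollectI exI[of _ "{\<omega>}"] exI[of _ "\<lambda>_. c"]) auto

lemma K_span_add:
  assumes "\<omega> \<in> K_span K \<kappa> S" "\<eta> \<in> K_span K \<kappa> S"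
  shows "\<omega> + \<eta> \<in> K_span K \<kappa> S"
proof -
  obtain T c where T: "\<omega> = (\<Sum>\<xi>\<in>T. const_fun \<kappa> (c \<xi>) *s \<xi>)" "finite T" "T \<subseteq> S" "\<And>\<xi>. \<xi> \<in> T \<Longrightarrow> c \<xi> \<in> K"
    using assms(1) by (auto simp: K_span_def)
  obtain U d where U: "\<eta> = (\<Sum>\<xi>\<in>U. const_fun \<kappa> (d \<xi>) *s \<xi>)" "finite U" "U \<subseteq> S" "\<And>\<xi>. \<xi> \<in> U \<Longrightarrow> d \<xi> \<in> K"
    using assms(2) by (auto simp: K_span_def)
  \<comment> \<open>The two combinations run over different finite sets; extending the coefficients
    by zero writes both over \<open>T \<union> U\<close>.\<close>
  define c' where "c' \<xi> = (if \<xi> \<in> T then c \<xi> else 0)" for \<xi>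
  define d' where "d' \<xi> = (if \<xi> \<in> U then d \<xi> else 0)" for \<xi>
  have "\<omega> = (\<Sum>\<xi>\<in>T \<union> U. const_fun \<kappa> (c' \<xi>) *s \<xi>)"
    unfolding T(1) c'_def using T U by (intro sum.mono_neutral_cong_left) (auto simp: const_fun_0)
  moreover have "\<eta> = (\<Sum>\<xi>\<in>T \<union> U. const_fun \<kappa> (d' \<xi>) *s \<xi>)"
    unfolding U(1) d'_def using T U by (intro sum.mono_neutral_cong_left) (auto simp: const_fun_0)
  ultimately have "\<omega> + \<eta> = (\<Sum>\<xi>\<in>T \<union> U. const_fun \<kappa> (c' \<xi> + d' \<xi>) *s \<xi>)"
    by (simp add: const_fun_add vector_sadd_rdistrib sum.distrib)
  moreover have "c' \<xi> + d' \<xi> \<in> K" if "\<xi> \<in> T \<union> U" for \<xi>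
    using that T U K_0 by (auto simp: c'_def d'_def intro!: K_add)
  ultimately show ?thesis
    unfolding K_span_def using T U
    by (intro CollectI exI[of _ "T \<union> U"] exI[of _ "\<lambda>\<xi>. c' \<xi> + d' \<xi>"]) auto
qed

lemma K_span_sum: "(\<And>i. i \<in> I \<Longrightarrow> \<omega> i \<in> K_span K \<kappa> S) \<Longrightarrow> sum \<omega> I \<in> K_span K \<kappa> S"
  by (induction I rule: infinite_finite_induct) (auto simp: K_span_0 K_span_add)

end

section \<open>Exact forms in the span and the recursion for the coefficients\<close>

context fraction_field
begin

text \<open>The single element 1 of the complex factor is independent over \<open>K\<close>, so this
  is the case of one summand in \<open>embeds\<close>.\<close>

lemma j_eq_0:
  assumes "f \<in> \<A>" "j f = 0"
  shows "f = 0"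
proof -
  have "K_independent K id 1 (\<lambda>_. 1)"
    by (simp add: K_independent_def)
  moreover have "(\<Sum>i<1::nat. j f * \<gamma> 1) = 0"
    using assms by simp
  ultimately show ?thesis
    using tensor_embedsD[OF embeds, of 1 "\<lambda>_. f" "\<lambda>_. 1" 0] assms(1) by simp
qed

text \<open>The C-form condition is stated in the fraction field, where \<open>j f\<close> is a
  primitive of the image of the form. The image therefore vanishes, and injectivity of
  \<open>j\<close> on \<A> brings this back to \<A>.\<close>

lemma exact_in_span_eq_0:
  assumes "meets_exact_trivially j \<delta> V" "f \<in> \<A>" "diff0 D f \<in> V"
  shows "diff0 D f = 0"
proof -
  have "map_form j (diff0 D f) = diff0 \<delta> (j f)"
    using assms by (simp add: map_form_def diff0_def derivations_extend)
  then have "map_form j (diff0 D f) \<in> map_form j ` V \<inter> range (diff0 \<delta>)"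
    by (metis IntI assms(3) imageI rangeI)
  then have "map_form j (diff0 D f) = 0"
    using assms(1) unfolding meets_exact_trivially_def by blast
  then have "j (D k f) = 0" for k
    by (simp add: map_form_def diff0_def vec_eq_iff)
  then show ?thesis
    using assms by (simp add: diff0_def vec_eq_iff j_eq_0 alg_closed)
qed

text \<open>The right-hand side of \<open>step\<close> mixes entries of \<open>A1\<close> and
  \<open>A2\<close>, which is why the C-form condition is imposed on their joint span.\<close>

lemma recursion_constant:
  fixes A1 A2 :: "('g, 'r) form1 ^ 'n ^ 'n::finite" and X :: "nat \<Rightarrow> 'g ^ 'n ^ 'n"
  assumes common: "meets_exact_trivially j \<delta> (K_span K \<kappa> (entries A1 \<union> entries A2))"
    and alg: "\<And>m a b. X m $ a $ b \<in> \<A>"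
    and zero: "\<And>a b. diff0 D (X 0 $ a $ b) = 0"
    and step: "\<And>m a b. diff0 D (X (Suc m) $ a $ b) =
      (\<Sum>l\<in>UNIV. X m $ l $ b *s A1 $ a $ l) + (\<Sum>l\<in>UNIV. X m $ a $ l *s A2 $ b $ l)"
  shows "diff0 D (X m $ a $ b) = 0"
proof (induction m arbitrary: a b)
  case (Suc m)
  \<comment> \<open>By the induction hypothesis these elements of \<A> are constants, so they come
    from \<open>K\<close> and may serve as coefficients in the span.\<close>
  have "X m $ a $ b \<in> const_fun \<kappa> ` K" for a b
    using Suc alg unfolding constants[symmetric] by (simp add: diff0_def vec_eq_iff)
  then have scale: "X m $ a $ b *s \<omega> \<in> K_span K \<kappa> S" if "\<omega> \<in> S" for a b S and \<omega> :: "('g, 'r) form1"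
    using K_span_scale[OF _ that] by (metis imageE)
  have mem: "A1 $ a $ l \<in> entries A1 \<union> entries A2"
    "A2 $ a $ l \<in> entries A1 \<union> entries A2" for a l
    by (auto simp: entries_def)
  have "diff0 D (X (Suc m) $ a $ b) \<in> K_span K \<kappa> (entries A1 \<union> entries A2)"
    unfolding step by (intro K_span_add K_span_sum scale mem)
  then show ?case
    by (rule exact_in_span_eq_0[OF common alg])
qed (rule zero)

text \<open>Clearing denominators turns \<open>eq\<close> into an identity in \<A>[\<epsilon>],
  whose coefficients satisfy the hypotheses of \<open>recursion_constant\<close>.\<close>

lemma intertwiner_constant:
  fixes A1 A2 :: "('g, 'r) form1 ^ 'n ^ 'n::finite" and \<Delta> :: "'g ^ 'n ^ 'n"
  assumes common: "meets_exact_trivially j \<delta> (K_span K \<kappa> (entries A1 \<union> entries A2))"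
    and forms: "entries A1 \<subseteq> forms1 \<A>" "entries A2 \<subseteq> forms1 \<A>"
    and entries: "entries \<Delta> \<subseteq> A_eps K \<kappa> \<A>"
    and eq: "\<And>k a b. D k (\<Delta> $ a $ b) = \<kappa> eps_rat *
      ((\<Sum>l\<in>UNIV. \<Delta> $ l $ b * A1 $ a $ l $ k) + (\<Sum>l\<in>UNIV. \<Delta> $ a $ l * A2 $ b $ l $ k))"
  shows "D k (\<Delta> $ a $ b) = 0"
proof -
  have A: "A1 $ a $ l $ k \<in> \<A>" "A2 $ a $ l $ k \<in> \<A>" for a l k
    using forms unfolding entries_def forms1_def by blast+
  have "entries \<Delta> = (\<lambda>(i, j). \<Delta> $ i $ j) ` UNIV"
    by (auto simp: entries_def)
  then have "finite (entries \<Delta>)"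
    by simp
  then have "\<exists>q. (\<forall>i. coeff q i \<in> K) \<and> q \<noteq> 0 \<and> (\<forall>f\<in>entries \<Delta>. clears q f)"
    using entries by (intro common_denominator A_eps_denominator) auto
  then obtain q where q: "q \<noteq> 0" "\<And>f. f \<in> entries \<Delta> \<Longrightarrow> clears q f"
    by auto
  have "clears q (\<Delta> $ a $ b)" for a b
    using q(2) by (auto simp: entries_def)
  then obtain X where X: "\<And>a b m. coeff (X a b) m \<in> \<A>"
    "\<And>a b. \<kappa> (to_fract q) * \<Delta> $ a $ b = poly (X a b) (\<kappa> eps_rat)"
    unfolding clears_def by metis
  \<comment> \<open>\<open>pCons 0\<close> is multiplication by \<epsilon>. Its zero constant term
    starts the recursion, and the shift by one degree gives the passage from \<open>m\<close> to
    \<open>Suc m\<close>.\<close>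
  define R where "R k a b = pCons 0 ((\<Sum>l\<in>UNIV. smult (A1 $ a $ l $ k) (X l b))
    + (\<Sum>l\<in>UNIV. smult (A2 $ b $ l $ k) (X a l)))" for k a b
  have q_scale: "D k (\<kappa> (to_fract q) * f) = \<kappa> (to_fract q) * D k f" for k f
    using derivations eps_const[of k] by (simp add: partial_derivations_def)
  \<comment> \<open>Both polynomials have coefficients in \<A> and agree at \<epsilon>, so they are
    equal as polynomials.\<close>
  have "map_poly (D k) (X a b) = R k a b" for k a b
  proof (rule poly_eps_rat_inject)
    show "coeff (map_poly (D k) (X a b)) i \<in> \<A>" for i
      by (simp add: coeff_map_poly partial_derivations_0[OF derivations] alg_closed X)
    show "coeff (R k a b) i \<in> \<A>" for i
      by (auto simp: R_def coeff_pCons coeff_sum alg_0 A X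
          intro!: alg_add alg_sum alg_mult split: nat.split)
    have "poly (map_poly (D k) (X a b)) (\<kappa> eps_rat) = \<kappa> (to_fract q) * D k (\<Delta> $ a $ b)"
      by (simp add: q_scale flip: derivation_poly_eps_rat X)
    also have "\<dots> = poly (R k a b) (\<kappa> eps_rat)"
      by (simp add: eq R_def poly_sum sum_distrib_left distrib_left mult_ac flip: X)
    finally show "poly (map_poly (D k) (X a b)) (\<kappa> eps_rat) = poly (R k a b) (\<kappa> eps_rat)" .
  qed
  then have coeff: "D k (coeff (X a b) m) = coeff (R k a b) m" for k a b m
    by (metis coeff_map_poly partial_derivations_0[OF derivations])
  \<comment> \<open>Regrouping by degree: \<open>Y m\<close> is the matrix of coefficients of the
    \<open>m\<close>-th power of \<epsilon>.\<close>
  define Y where "Y m = (\<chi> a b. coeff (X a b) m)" for m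
  have "diff0 D (Y m $ a $ b) = 0" for m a b
    by (rule recursion_constant[OF common])
      (simp_all add: Y_def X diff0_def coeff R_def vec_eq_iff coeff_sum mult.commute)
  then have "map_poly (D k) (X a b) = 0"
    by (simp add: poly_eq_iff coeff_map_poly partial_derivations_0[OF derivations]
        Y_def diff0_def vec_eq_iff)
  then have "\<kappa> (to_fract q) * D k (\<Delta> $ a $ b) = 0"
    using derivation_poly_eps_rat[of k "X a b"] by (simp add: q_scale flip: X)
  \<comment> \<open>The ring \<open>'g\<close> may have zero divisors, but a nonzero
    \<open>q\<close> is invertible among the rational functions, so its image under \<kappa> is a
    unit and cancels.\<close>
  moreover have "\<kappa> (inverse (to_fract q)) * \<kappa> (to_fract q) = 1"
    using q(1) by (simp add: kappa_1 flip: kappa_mult)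
  ultimately show ?thesis
    by (metis mult.assoc mult_1 mult_zero_right)
qed

end

section \<open>From the two systems to a linear equation for \<Delta>\<close>

lemma eps_solution_derivation:
  fixes D :: "'r::finite \<Rightarrow> 'g::comm_ring_1 \<Rightarrow> 'g" and A :: "('g, 'r) form1 ^ 'n ^ 'n::finite"
  assumes "eps_solution \<kappa> D A G"
  shows "map_matrix (D k) G = (\<chi> a l. \<kappa> eps_rat * A $ a $ l $ k) ** G"
proof -
  have "D k (G $ a $ b) = \<kappa> eps_rat * (\<Sum>l\<in>UNIV. G $ l $ b * A $ a $ l $ k)" for a b
  proof -
    have "map_matrix (diff0 D) G $ a $ b $ k =
      map_matrix (\<lambda>\<omega>. \<kappa> eps_rat *s \<omega>) (form_matrix_mult A G) $ a $ b $ k"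
      using assms by (simp only: eps_solution_def)
    then show ?thesis
      by (simp add: diff0_def form_matrix_mult_def)
  qed
  then show ?thesis
    by (simp add: vec_eq_iff matrix_matrix_mult_def sum_distrib_left mult_ac)
qed

theorem corollary1:
  fixes K :: "complex set"
    and \<kappa> :: "complex poly fract \<Rightarrow> 'g::comm_ring_1"
    and D :: "'r::finite \<Rightarrow> 'g \<Rightarrow> 'g"
    and \<A> :: "'g set"
    and j :: "'g \<Rightarrow> 'f::field"
    and \<gamma> :: "complex \<Rightarrow> 'f"
    and \<delta> :: "'r \<Rightarrow> 'f \<Rightarrow> 'f"
    and A1 A2 :: "('g, 'r) form1 ^ 'n ^ 'n::finite"
    and G1 G2 \<Delta> :: "'g ^ 'n ^ 'n"
    and H :: "complex poly fract ^ 'n ^ 'n"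
  assumes setting: "fraction_field K \<kappa> D \<A> j \<gamma> \<delta>"
    and C_form1: "C_form K \<kappa> D \<A> j \<delta> A1"
    and C_form2: "C_form K \<kappa> D \<A> j \<delta> A2"
    and common_C_form: "meets_exact_trivially j \<delta> (K_span K \<kappa> (entries A1 \<union> entries A2))"
    and system1: "eps_solution \<kappa> D A1 G1"
    and system2: "eps_solution \<kappa> D A2 G2"
    and Delta_GL: "\<Delta> \<in> GL (A_eps K \<kappa> \<A>)"
    and H_GL: "H \<in> GL UNIV"
    and relation: "G1 ** map_matrix \<kappa> (transpose (matrix_inv H)) ** transpose G2 = \<Delta>"
  shows "map_matrix (diff0 D) \<Delta> = 0"
proof -
  interpret fraction_field K \<kappa> D \<A> j \<gamma> \<delta>
    by (rule setting)
  define M where "M = map_matrix \<kappa> (transpose (matrix_inv H))"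
  \<comment> \<open>Fixing the coordinate \<open>k\<close> turns the connection into an ordinary
    matrix, so the product rule for matrices applies.\<close>
  define B where "B A k = (\<chi> a l. \<kappa> eps_rat * A $ a $ l $ k)"
    for A :: "('g, 'r) form1 ^ 'n ^ 'n" and k
  \<comment> \<open>The entries of \<open>M\<close> are images of rational functions of \<epsilon>
    alone.\<close>
  have dM: "map_matrix (D k) M = 0" for k
    by (simp add: M_def vec_eq_iff eps_const)
  have dG: "map_matrix (D k) G1 = B A1 k ** G1" "map_matrix (D k) G2 = B A2 k ** G2" for k
    using system1 system2 by (simp_all add: eps_solution_derivation B_def)
  have dG2T: "map_matrix (D k) (transpose G2) = transpose G2 ** transpose (B A2 k)" for k
  proof -
    have "map_matrix (D k) (transpose G2) = transpose (map_matrix (D k) G2)"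
      by (simp add: vec_eq_iff transpose_def)
    then show ?thesis
      by (simp add: dG matrix_transpose_mul)
  qed
  \<comment> \<open>Of the three terms of the product rule the middle one vanishes by
    \<open>dM\<close>. In the outer ones the connection matrices stand at the far left and far
    right, so the remaining factors recombine to \<Delta>.\<close>
  have "map_matrix (D k) \<Delta> = B A1 k ** \<Delta> + \<Delta> ** transpose (B A2 k)" for k
    by (simp add: map_matrix_derivation_mult[OF derivations] dM dG dG2T matrix_mul_assoc
        flip: relation M_def)
  then have "map_matrix (D k) \<Delta> $ a $ b = (B A1 k ** \<Delta> + \<Delta> ** transpose (B A2 k)) $ a $ b" for k a b
    by simp
  then have "D k (\<Delta> $ a $ b) = \<kappa> eps_rat *
      ((\<Sum>l\<in>UNIV. \<Delta> $ l $ b * A1 $ a $ l $ k) + (\<Sum>l\<in>UNIV. \<Delta> $ a $ l * A2 $ b $ l $ k))" for k a b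
    by (simp add: B_def matrix_matrix_mult_def transpose_def sum_distrib_left distrib_left mult_ac)
  moreover have "entries A1 \<subseteq> forms1 \<A>" "entries A2 \<subseteq> forms1 \<A>" "entries \<Delta> \<subseteq> A_eps K \<kappa> \<A>"
    using C_form1 C_form2 Delta_GL by (auto simp only: C_form_def flat_connection_def GL_def)
  ultimately have "D k (\<Delta> $ a $ b) = 0" for k a b
    by (intro intertwiner_constant[OF common_C_form])
  then show ?thesis
    by (simp add: vec_eq_iff diff0_def)
qed

end
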